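(* Let $L$ be a complete lattice, let $X$ be a nonempty set and let $\mu: X\to L$ be an $L$-fuzzy set. Then: (a) $(\mu_L,\supseteq)\cong (L^{\mu},\leq)$, i.e. the family of cuts of $\mu$ ordered by reverse inclusion is order-isomorphic to $L^{\mu}$ with the order inherited from $L$; (b) $L^{\mu}$ can be embedded into $L$ by $\iota_{(L^{\mu},L)}$-embedding; (c) $\mu=\iota_{(L^{\mu},L)}\circ\nu$, where $\nu: X\to L^{\mu}$ is defined by $\nu(x)=\mu(x)$ for all $x\in X$; moreover $\nu_{L^{\mu}}=\mu_L$ and $(L^{\mu})^{\nu}=L^{\mu}$.
   Context: An $L$-fuzzy set on a nonempty set $X$ is a mapping $\mu:X\to L$ into a complete lattice $(L,\wedge,\vee,0_L,1_L)$. For $p\in L$, the $p$-cut of $\mu$ is $\mu_p=\{x\in X\mid \mu(x)\geq p\}$, and $\mu_L=\{\mu_p\mid p\in L\}$ is the family of all cuts. Put $L^{\mu}=\{p\in L\mid p=\bigwedge B \text{ for some } B\subseteq \mu(X)\}$, where $\mu(X)=\{\mu(x)\mid x\in X\}$ and $\bigwedge\emptyset=1_L$; $L^{\mu}$ with the order of $L$ is a complete lattice. For a sub-poset $(M,\leq)$ of a poset $(N,\leq)$, $\iota_{(M,N)}:M\to N$ denotes the inclusion map $\iota_{(M,N)}(x)=x$. If $(L_1,\leq)$ is a sub-poset of a complete lattice $(L,\leq)$, the map $\iota_{(L_1,L)}$ is called an $\iota_{(L_1,L)}$-embedding (and "$L_1$ can be embedded into $L$ by $\iota_{(L_1,L)}$-embedding")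 if it preserves all infima and the top element: for every $S\subseteq L_1$ the infimum of $S$ in $L_1$ exists and equals the infimum of $S$ in $L$, and the top element of $L_1$ is $1_L$. For a complete lattice $K$ and $\nu:X\to K$, $\nu_K$ and $K^{\nu}$ are defined analogously with $K$ in place of $L$. *)

theory Defs
  imports "HOL-Algebra.Complete_Lattice"
begin

text \<open>
  Lattices are carrier-based (records of type \<open>gorder\<close>), because \<open>L\<^sup>\<mu>\<close> is a poset on a subset of
  \<open>L\<close> that must itself serve as the codomain of an \<open>L\<close>-fuzzy set. For a partial order, equality
  on the carrier is HOL equality; functions are only considered on \<open>X\<close> or on a carrier.
\<close>

definition fuzzy_set :: "('a, 'c) gorder_scheme \<Rightarrow> 'x set \<Rightarrow> ('x \<Rightarrow> 'a) \<Rightarrow> bool" where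
  "fuzzy_set L X \<mu> \<longleftrightarrow> complete_lattice L \<and> X \<noteq> {} \<and> \<mu> \<in> X \<rightarrow> carrier L"

definition p_cut :: "('a, 'c) gorder_scheme \<Rightarrow> 'x set \<Rightarrow> ('x \<Rightarrow> 'a) \<Rightarrow> 'a \<Rightarrow> 'x set" where
  "p_cut L X \<mu> p = {x \<in> X. p \<sqsubseteq>\<^bsub>L\<^esub> \<mu> x}"

definition cuts :: "('a, 'c) gorder_scheme \<Rightarrow> 'x set \<Rightarrow> ('x \<Rightarrow> 'a) \<Rightarrow> 'x set set" where
  "cuts L X \<mu> = p_cut L X \<mu> ` carrier L"

definition cuts_poset :: "('a, 'c) gorder_scheme \<Rightarrow> 'x set \<Rightarrow> ('x \<Rightarrow> 'a) \<Rightarrow> 'x set gorder" where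
  "cuts_poset L X \<mu> = \<lparr>carrier = cuts L X \<mu>, eq = (=), le = (\<lambda>A B. A \<supseteq> B)\<rparr>"

text \<open>
  The poset \<open>L\<^sup>\<mu>\<close> with the order of \<open>L\<close>. The choice \<open>B = {}\<close> contributes the top element of \<open>L\<close>,
  the infimum of the empty set being the greatest element of the whole carrier.
\<close>

definition image_inf_poset ::
    "('a, 'c) gorder_scheme \<Rightarrow> 'x set \<Rightarrow> ('x \<Rightarrow> 'a) \<Rightarrow> ('a, 'c) gorder_scheme" where
  "image_inf_poset L X \<mu> =
     L\<lparr>carrier := {p \<in> carrier L. \<exists>B. B \<subseteq> \<mu> ` X \<and> p = \<Sqinter>\<^bsub>L\<^esub>B}\<rparr>"

definition order_isomorphic ::
    "('a, 'c) gorder_scheme \<Rightarrow> ('b, 'd) gorder_scheme \<Rightarrow> bool" where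
  "order_isomorphic A B \<longleftrightarrow> partial_order A \<and> partial_order B \<and>
     (\<exists>f. bij_betw f (carrier A) (carrier B) \<and> order_emb A B f)"

definition sub_poset :: "('a, 'c) gorder_scheme \<Rightarrow> ('a, 'd) gorder_scheme \<Rightarrow> bool" where
  "sub_poset M N \<longleftrightarrow> partial_order M \<and> partial_order N \<and> carrier M \<subseteq> carrier N \<and>
     (\<forall>x\<in>carrier M. \<forall>y\<in>carrier M. x \<sqsubseteq>\<^bsub>M\<^esub> y \<longleftrightarrow> x \<sqsubseteq>\<^bsub>N\<^esub> y)"

text \<open>The codomain \<open>N\<close> of the inclusion map does not affect its values.\<close>

definition incl_map :: "('a, 'c) gorder_scheme \<Rightarrow> ('a, 'd) gorder_scheme \<Rightarrow> 'a \<Rightarrow> 'a" where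
  "incl_map M N = (\<lambda>x\<in>carrier M. x)"

definition incl_embedding :: "('a, 'c) gorder_scheme \<Rightarrow> ('a, 'd) gorder_scheme \<Rightarrow> bool" where
  "incl_embedding M N \<longleftrightarrow> complete_lattice N \<and> sub_poset M N \<and>
     (\<forall>S. S \<subseteq> carrier M \<longrightarrow>
        (\<exists>i. is_glb M i S \<and> is_glb N (incl_map M N i) (incl_map M N ` S))) \<and>
     greatest M \<top>\<^bsub>N\<^esub> (carrier M)"

end

theory Submission
  imports Defs
begin

text \<open>
  The map \<open>p \<mapsto> \<Sqinter> \<mu>(\<mu>\<^sub>p)\<close> is a closure operator on \<open>L\<close>. Its closed elements are exactly those
  of \<open>L\<^sup>\<mu>\<close>, and \<open>p\<close> and its closure have the same cut, so \<open>A \<mapsto> \<Sqinter> \<mu>(A)\<close> is an order isomorphism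
  from the cuts, ordered by reverse inclusion, to \<open>L\<^sup>\<mu>\<close>. Closed elements are stable under
  infima, so infima of subsets of \<open>L\<^sup>\<mu>\<close> may be computed in \<open>L\<close>, which gives the rest.
\<close>

section \<open>Subsets of a complete lattice that are closed under infima\<close>

lemma (in partial_order) partial_order_subset:
  assumes "A \<subseteq> carrier L"
  shows "partial_order (L\<lparr>carrier := A\<rparr>)"
proof -
  interpret A: weak_partial_order "L\<lparr>carrier := A\<rparr>"
    by (rule weak_partial_order_subset[OF weak_partial_order_axioms assms])
  show ?thesis
    by unfold_locales (simp add: eq_is_equal)
qed

lemma (in partial_order) glb_unique:
  assumes "is_glb L i S" "is_glb L j S"
  shows "i = j"
  using weak_greatest_unique[OF assms] by (simp add: eq_is_equal)

text \<open>Lower bounds of \<open>S\<close> taken in \<open>A\<close> are among those taken in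
  \<open>L\<close>, so an infimum computed in \<open>L\<close> stays the greatest of them once it
  lies in \<open>A\<close>.\<close>

lemma (in complete_lattice) glb_subset:
  assumes A: "A \<subseteq> carrier L" and S: "S \<subseteq> A" and i: "\<Sqinter>S \<in> A"
  shows "is_glb (L\<lparr>carrier := A\<rparr>) (\<Sqinter>S) S"
proof (rule greatest_LowerI)
  have SL: "S \<subseteq> carrier L" using A S by blast
  show "\<And>x. x \<in> S \<Longrightarrow> \<Sqinter>S \<sqsubseteq>\<^bsub>L\<lparr>carrier := A\<rparr>\<^esub> x"
    using inf_lower[OF SL] by simp
  show "y \<sqsubseteq>\<^bsub>L\<lparr>carrier := A\<rparr>\<^esub> \<Sqinter>S" if "y \<in> Lower (L\<lparr>carrier := A\<rparr>) S" for y
    using that A S by (auto simp: Lower_def intro!: inf_greatest[OF SL])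
qed (use S i in auto)

lemma (in complete_lattice) inf_subset:
  assumes "A \<subseteq> carrier L" "S \<subseteq> A" "\<Sqinter>S \<in> A"
  shows "\<Sqinter>\<^bsub>L\<lparr>carrier := A\<rparr>\<^esub>S = \<Sqinter>S"
proof -
  interpret A: partial_order "L\<lparr>carrier := A\<rparr>"
    by (rule partial_order_subset[OF assms(1)])
  have "is_glb (L\<lparr>carrier := A\<rparr>) (\<Sqinter>S) S" by (rule glb_subset[OF assms])
  \<comment> \<open>\<open>inf\<close> is defined by Hilbert choice, so its value is pinned down
    only through uniqueness of the greatest lower bound in \<open>A\<close>.\<close>
  then show ?thesis
    unfolding inf_def[of "L\<lparr>carrier := A\<rparr>"] by (blast intro: someI2 A.glb_unique)
qed

lemma (in complete_lattice) inf_empty_eq: "\<Sqinter>{} = \<top>"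
  using weak_inf_empty by (simp add: eq_is_equal)

lemma (in complete_lattice) complete_lattice_inf_closed_subset:
  assumes A: "A \<subseteq> carrier L" and closed: "\<And>S. S \<subseteq> A \<Longrightarrow> \<Sqinter>S \<in> A"
  shows "complete_lattice (L\<lparr>carrier := A\<rparr>)"
proof -
  interpret A: partial_order "L\<lparr>carrier := A\<rparr>"
    by (rule partial_order_subset[OF A])
  have glb: "\<exists>i. is_glb (L\<lparr>carrier := A\<rparr>) i S" if "S \<subseteq> A" for S
    using glb_subset[OF A that closed[OF that]] ..
  \<comment> \<open>Every element of \<open>A\<close> is a lower bound of the empty set, so the
    instance \<open>{}\<close> supplies the top element that the criterion asks for.\<close>
  show ?thesis
    using glb glb[of "{}"] by (intro A.complete_lattice_criterion1) auto
qed

lemma (in complete_lattice) incl_embedding_inf_closed_subset: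
  assumes A: "A \<subseteq> carrier L" and closed: "\<And>S. S \<subseteq> A \<Longrightarrow> \<Sqinter>S \<in> A"
  shows "incl_embedding (L\<lparr>carrier := A\<rparr>) L"
proof -
  have "\<exists>i. is_glb (L\<lparr>carrier := A\<rparr>) i S \<and>
      is_glb L (incl_map (L\<lparr>carrier := A\<rparr>) L i) (incl_map (L\<lparr>carrier := A\<rparr>) L ` S)"
    if S: "S \<subseteq> A" for S
  proof -
    have "incl_map (L\<lparr>carrier := A\<rparr>) L ` S = S"
      using S by (auto simp: incl_map_def image_iff subset_iff)
    moreover have "is_glb L (\<Sqinter>S) S" using S A by (intro inf_glb) blast
    ultimately show ?thesis
      using glb_subset[OF A S closed[OF S]] closed[OF S] by (auto simp: incl_map_def)
  qed
  \<comment> \<open>The top of \<open>L\<close> is the infimum of the empty set, hence lies in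
    \<open>A\<close> by closedness.\<close>
  moreover have "greatest (L\<lparr>carrier := A\<rparr>) \<top> A"
    using closed[of "{}"] A by (auto simp: greatest_def inf_empty_eq subset_iff)
  ultimately show ?thesis
    using partial_order_subset[OF A] A
    by (simp add: incl_embedding_def sub_poset_def complete_lattice_axioms partial_order_axioms)
qed

section \<open>The closure operator and its closed elements\<close>

locale lattice_valued_fuzzy_set = complete_lattice L
  for L :: "('a, 'c) gorder_scheme" (structure) +
  fixes X :: "'x set" and \<mu> :: "'x \<Rightarrow> 'a"
  assumes value_closed: "\<mu> \<in> X \<rightarrow> carrier L"
begin

abbreviation closure :: "'a \<Rightarrow> 'a"
  where "closure p \<equiv> \<Sqinter>(\<mu> ` p_cut L X \<mu> p)"

abbreviation K :: "('a, 'c) gorder_scheme"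
  where "K \<equiv> image_inf_poset L X \<mu>"

lemma image_cut_subset: "\<mu> ` p_cut L X \<mu> p \<subseteq> carrier L"
  using value_closed by (auto simp: p_cut_def)

lemma closure_extensive: "p \<in> carrier L \<Longrightarrow> p \<sqsubseteq> closure p"
  by (rule inf_greatest[OF image_cut_subset]) (auto simp: p_cut_def)

lemma cut_antimono:
  assumes "p \<sqsubseteq> q" "p \<in> carrier L" "q \<in> carrier L"
  shows "p_cut L X \<mu> q \<subseteq> p_cut L X \<mu> p"
  using assms value_closed by (auto simp: p_cut_def intro: le_trans)

text \<open>A larger cut has a smaller infimum of values. Assuming inclusion of cuts instead of
  \<open>p \<sqsubseteq> q\<close> lets the same fact serve for the order isomorphism.\<close>

lemma closure_mono:
  assumes "p_cut L X \<mu> q \<subseteq> p_cut L X \<mu> p"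
  shows "closure p \<sqsubseteq> closure q"
  using assms image_cut_subset
  by (intro inf_greatest[OF image_cut_subset])
    (auto intro!: inf_lower[OF image_cut_subset] inf_closed)

text \<open>One inclusion is antitonicity of cuts applied to
  \<open>p \<sqsubseteq> closure p\<close>; for the other, \<open>closure p\<close> is a lower bound
  of the values on the cut of \<open>p\<close>.\<close>

lemma cut_closure:
  assumes "p \<in> carrier L"
  shows "p_cut L X \<mu> (closure p) = p_cut L X \<mu> p"
proof
  show "p_cut L X \<mu> (closure p) \<subseteq> p_cut L X \<mu> p"
    using assms image_cut_subset by (intro cut_antimono closure_extensive) auto
  show "p_cut L X \<mu> p \<subseteq> p_cut L X \<mu> (closure p)"
    using inf_lower[OF image_cut_subset] by (auto simp: p_cut_def)
qed

text \<open>Brings \<open>K\<close> into the form to which the results on restricted carriers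
  apply.\<close>

lemma image_inf_poset_eq: "K = L\<lparr>carrier := carrier K\<rparr>"
  by (simp add: image_inf_poset_def)

lemma image_inf_carrier_subset: "carrier K \<subseteq> carrier L"
  by (auto simp: image_inf_poset_def)

lemma le_image_inf_poset: "x \<sqsubseteq>\<^bsub>K\<^esub> y \<longleftrightarrow> x \<sqsubseteq> y"
  by (simp add: image_inf_poset_def)

lemma closure_in_image_inf: "closure p \<in> carrier K"
proof -
  have "\<mu> ` p_cut L X \<mu> p \<subseteq> \<mu> ` X" by (auto simp: p_cut_def)
  then show ?thesis
    using inf_closed[OF image_cut_subset] unfolding image_inf_poset_def by auto
qed

text \<open>If \<open>p\<close> is the infimum of a set \<open>B\<close> of values, each member of
  \<open>B\<close> is above \<open>p\<close> and so is a value taken on the cut of \<open>p\<close>.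
  Thus \<open>closure p\<close> is below the infimum of \<open>B\<close>, which is
  \<open>p\<close>.\<close>

lemma closure_eq:
  assumes "p \<in> carrier K"
  shows "closure p = p"
proof -
  from assms obtain B where p: "p \<in> carrier L" and B: "B \<subseteq> \<mu> ` X" and pB: "p = \<Sqinter>B"
    by (auto simp: image_inf_poset_def)
  have BL: "B \<subseteq> carrier L" using B value_closed by auto
  have "B \<subseteq> \<mu> ` p_cut L X \<mu> p"
    using B inf_lower[OF BL] by (auto simp: p_cut_def pB)
  then have "closure p \<sqsubseteq> \<Sqinter>B"
    using BL image_cut_subset
    by (intro inf_greatest inf_closed inf_lower) auto
  then have "closure p \<sqsubseteq> p" by (simp flip: pB)
  then show ?thesis
    using closure_extensive[OF p] p image_cut_subset by (intro le_antisym) auto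
qed

lemma closure_eq_imp_image_inf: "closure p = p \<Longrightarrow> p \<in> carrier K"
  using closure_in_image_inf[of p] by simp

text \<open>By monotonicity, the closure of the infimum lies below \<open>closure s = s\<close> for
  each \<open>s\<close> in \<open>S\<close>, hence below the infimum itself.\<close>

lemma inf_in_image_inf:
  assumes S: "S \<subseteq> carrier K"
  shows "\<Sqinter>S \<in> carrier K"
proof (rule closure_eq_imp_image_inf)
  have SL: "S \<subseteq> carrier L" using S image_inf_carrier_subset by blast
  have "closure (\<Sqinter>S) \<sqsubseteq> s" if "s \<in> S" for s
  proof -
    have "closure (\<Sqinter>S) \<sqsubseteq> closure s"
      using that SL by (intro closure_mono cut_antimono inf_lower) auto
    then show ?thesis using closure_eq S that by auto
  qed
  then have "closure (\<Sqinter>S) \<sqsubseteq> \<Sqinter>S"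
    using SL image_cut_subset by (intro inf_greatest) auto
  then show "closure (\<Sqinter>S) = \<Sqinter>S"
    using SL image_cut_subset closure_extensive by (intro le_antisym) auto
qed

lemma value_in_image_inf:
  assumes "x \<in> X"
  shows "\<mu> x \<in> carrier K"
proof -
  have "\<mu> x \<in> carrier L" using assms value_closed by auto
  moreover from this have "\<mu> x = \<Sqinter>{\<mu> x}" by simp
  ultimately show ?thesis
    using assms unfolding image_inf_poset_def by (auto intro!: exI[of _ "{\<mu> x}"])
qed

lemma complete_lattice_image_inf: "complete_lattice K"
  using complete_lattice_inf_closed_subset[OF image_inf_carrier_subset inf_in_image_inf]
  by (simp flip: image_inf_poset_eq)

lemma incl_embedding_image_inf: "incl_embedding K L"
  using incl_embedding_inf_closed_subset[OF image_inf_carrier_subset inf_in_image_inf]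
  by (simp flip: image_inf_poset_eq)

lemma inf_image_inf_poset:
  assumes "S \<subseteq> carrier K"
  shows "\<Sqinter>\<^bsub>K\<^esub>S = \<Sqinter>S"
  using inf_subset[OF image_inf_carrier_subset assms inf_in_image_inf[OF assms]]
  by (simp flip: image_inf_poset_eq)

section \<open>The lattice of cuts, and the fuzzy set with values in \<open>K\<close>\<close>

lemma partial_order_cuts_poset: "partial_order (cuts_poset L X \<mu>)"
  by unfold_locales (auto simp: cuts_poset_def)

lemma cuts_isomorphic: "order_isomorphic (cuts_poset L X \<mu>) K"
proof -
  let ?f = "\<lambda>A. \<Sqinter>(\<mu> ` A)"
  have pK: "partial_order K"
    using partial_order_subset[OF image_inf_carrier_subset] by (simp flip: image_inf_poset_eq)
  have bij: "bij_betw ?f (cuts L X \<mu>) (carrier K)"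
  \<comment> \<open>On the cut of \<open>p\<close>, \<open>?f\<close> yields
    \<open>closure p\<close>, so the two round trips are \<open>cut_closure\<close> and
    \<open>closure_eq\<close>.\<close>
  proof (rule bij_betw_byWitness[where f' = "p_cut L X \<mu>"])
    show "\<forall>A\<in>cuts L X \<mu>. p_cut L X \<mu> (?f A) = A"
      by (auto simp: cuts_def cut_closure)
    show "\<forall>p\<in>carrier K. closure p = p"
      by (simp add: closure_eq)
    show "?f ` cuts L X \<mu> \<subseteq> carrier K"
      using closure_in_image_inf by (auto simp: cuts_def)
    show "p_cut L X \<mu> ` carrier K \<subseteq> cuts L X \<mu>"
      using image_inf_carrier_subset by (auto simp: cuts_def)
  qed
  have emb: "?f A \<sqsubseteq> ?f B \<longleftrightarrow> B \<subseteq> A" if AB: "A \<in> cuts L X \<mu>" "B \<in> cuts L X \<mu>" for A B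
  proof -
    obtain p q where p: "p \<in> carrier L" "A = p_cut L X \<mu> p"
      and q: "q \<in> carrier L" "B = p_cut L X \<mu> q"
      using AB by (auto simp: cuts_def)
    \<comment> \<open>From right to left this is \<open>closure_mono\<close>. From left to right,
      antitonicity is applied to the two closures, whose cuts are again \<open>A\<close> and
      \<open>B\<close>.\<close>
    show ?thesis
      using closure_mono[of q p] cut_antimono[of "closure p" "closure q"]
        image_cut_subset cut_closure p q by auto
  qed
  have "order_emb (cuts_poset L X \<mu>) K ?f"
    using partial_order.axioms(1)[OF pK] partial_order.axioms(1)[OF partial_order_cuts_poset] emb
    by (simp add: order_emb_def le_image_inf_poset) (simp add: cuts_poset_def)
  then show ?thesis
    using pK partial_order_cuts_poset bij
    unfolding order_isomorphic_def by (auto simp: cuts_poset_def)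
qed

text \<open>Passing to \<open>K\<close> leaves fewer thresholds, but loses no cut: any
  \<open>p\<close> in \<open>L\<close> may be replaced by \<open>closure p\<close>, which lies in
  \<open>K\<close> and has the same cut.\<close>

lemma cuts_restrict_image_inf: "cuts K X (restrict \<mu> X) = cuts L X \<mu>"
proof -
  have cut: "p_cut K X (restrict \<mu> X) p = p_cut L X \<mu> p" for p
    by (auto simp: p_cut_def le_image_inf_poset)
  have "p_cut L X \<mu> p \<in> p_cut L X \<mu> ` carrier K" if "p \<in> carrier L" for p
    using cut_closure[OF that] closure_in_image_inf by (metis image_eqI)
  then show ?thesis
    using image_inf_carrier_subset by (auto simp: cuts_def cut)
qed

text \<open>All values lie in \<open>K\<close>, so their infima are the same in \<open>K\<close> as
  in \<open>L\<close>, and repeating the construction adds or removes nothing.\<close>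

lemma image_inf_poset_restrict_image_inf: "image_inf_poset K X (restrict \<mu> X) = K"
proof -
  have "\<Sqinter>\<^bsub>K\<^esub>B = \<Sqinter>B" if "B \<subseteq> \<mu> ` X" for B
    using that value_in_image_inf by (intro inf_image_inf_poset) auto
  then have "{p \<in> carrier K. \<exists>B\<subseteq>\<mu> ` X. p = \<Sqinter>\<^bsub>K\<^esub>B} = carrier K"
    by (auto simp: image_inf_poset_def[of L])
  then show ?thesis
    by (simp add: image_inf_poset_def[of K])
qed

end

theorem theorem4:
  fixes L :: "('a, 'c) gorder_scheme" and X :: "'x set" and \<mu> :: "'x \<Rightarrow> 'a"
  assumes "complete_lattice L" and "X \<noteq> {}" and "fuzzy_set L X \<mu>"
  shows "order_isomorphic (cuts_poset L X \<mu>) (image_inf_poset L X \<mu>) \<and>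
    incl_embedding (image_inf_poset L X \<mu>) L \<and>
    (let K = image_inf_poset L X \<mu>; \<nu> = (\<lambda>x\<in>X. \<mu> x) in
      fuzzy_set K X \<nu> \<and>
      (\<forall>x\<in>X. \<mu> x = (incl_map K L \<circ> \<nu>) x) \<and>
      cuts K X \<nu> = cuts L X \<mu> \<and>
      image_inf_poset K X \<nu> = K)"
proof -
  interpret lattice_valued_fuzzy_set L X \<mu>
    using assms
    by (simp add: lattice_valued_fuzzy_set_def lattice_valued_fuzzy_set_axioms_def fuzzy_set_def)
  show ?thesis
    using cuts_isomorphic incl_embedding_image_inf complete_lattice_image_inf assms(2)
      value_in_image_inf cuts_restrict_image_inf image_inf_poset_restrict_image_inf
    by (auto simp: Let_def fuzzy_set_def incl_map_def)
qed

end
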